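(* We have $$\sum_{n\geq 0} DSOME(n)q^n=\frac{1}{8}\left(\frac{f_2}{f_1}-\frac{f_1^7}{f_2^3}\right).$$
   Context: For an integer $n\ge 0$, $DSOME(n)$ denotes the sum of all the odd parts in all the partitions of $n$ into distinct parts minus the sum of all the even parts in all the partitions of $n$ into distinct parts. That is, $DSOME(n)=\sum_{\lambda}\left(\sum_{\lambda_i \text{ odd}}\lambda_i-\sum_{\lambda_i\text{ even}}\lambda_i\right)$, where $\lambda$ runs over all partitions of $n$ into distinct parts and $\lambda_i$ runs over the parts of $\lambda$; in particular $DSOME(0)=0$. Here $q$ is a complex number with $|q|<1$ (equivalently, the identity may be read as one of formal power series in $q$), $(a;q)_\infty:=\prod_{k\ge 0}(1-aq^k)$, and $f_n:=(q^n;q^n)_\infty=\prod_{k\ge 1}(1-q^{nk})$ for integers $n\ge 1$. *)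

theory Defs
  imports "HOL-Analysis.Analysis" "HOL-Library.Multiset"
begin

definition partitions :: "nat \<Rightarrow> nat multiset set" where
  "partitions n = {p. 0 \<notin># p \<and> \<Sum>\<^sub># p = n}"

definition distinct_partitions :: "nat \<Rightarrow> nat multiset set" where
  "distinct_partitions n = {p \<in> partitions n. \<forall>x. count p x \<le> 1}"

definition DSOME :: "nat \<Rightarrow> int" where
  "DSOME n = (\<Sum>p\<in>distinct_partitions n.
     (\<Sum>x\<in>#filter_mset odd p. int x) - (\<Sum>x\<in>#filter_mset even p. int x))"

text \<open>The outer sum in \<open>DSOME\<close> is over a finite set, so it does not default to zero.\<close>

lemma finite_distinct_partitions: "finite (distinct_partitions n)"
proof (rule finite_subset)
  show "distinct_partitions n \<subseteq> mset_set ` Pow {..n}"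
  proof
    fix p assume "p \<in> distinct_partitions n"
    then have n: "\<Sum>\<^sub># p = n" and c: "\<And>x. count p x \<le> 1"
      by (auto simp: distinct_partitions_def partitions_def)
    have "p = mset_set (set_mset p)"
    proof (rule multiset_eqI)
      fix x show "count p x = count (mset_set (set_mset p)) x"
        using c[of x] by (cases "x \<in># p") (auto simp: le_Suc_eq count_eq_zero_iff)
    qed
    moreover have "set_mset p \<subseteq> {..n}"
    proof
      fix x assume "x \<in># p"
      then obtain p' where "p = add_mset x p'"
        by (blast dest: multi_member_split)
      then show "x \<in> {..n}" using n by auto
    qed
    ultimately show "p \<in> mset_set ` Pow {..n}" by blast
  qed
qed simp

text \<open>\<open>qpochhammer_inf a q\<close> is $(a;q)_\infty$; it is meaningful for \<open>norm q < 1\<close>.\<close>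

definition qpochhammer_inf :: "complex \<Rightarrow> complex \<Rightarrow> complex" where
  "qpochhammer_inf a q = (\<Prod>k. 1 - a * q ^ k)"

text \<open>\<open>euler_f n q\<close> is $f_n = (q^n;q^n)_\infty$, for \<open>n \<ge> 1\<close>.\<close>

definition euler_f :: "nat \<Rightarrow> complex \<Rightarrow> complex" where
  "euler_f n q = qpochhammer_inf (q ^ n) (q ^ n)"

end

theory Submission
  imports Defs
begin

text \<open>
  Summing \<open>\<plusminus>k\<close> over the parts of all partitions into distinct parts gives the generating function
  \<open>\<Prod>k. (1 + q ^ k)\<close> times the Lambert series \<open>\<Sum>k. (-1) ^ (k - 1) * k * q ^ k / (1 + q ^ k)\<close>. The product is
  \<open>f\<^sub>2 / f\<^sub>1\<close>, so the theorem amounts to Jacobi's four-square identity, namely that the Lambert series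
  is \<open>(1 - P ^ 4) / 8\<close> for \<open>P = f\<^sub>1\<^sup>2 / f\<^sub>2 = \<Prod>k. (1 - q ^ k) / (1 + q ^ k)\<close>. With \<open>P\<^sub>N\<close> the
  \<open>N\<close>-th partial product, Lagrange interpolation at powers of \<open>q\<close> yields the finite identity
  \<open>P\<^sub>N\<^sup>2 = 1 / P\<^sub>N\<^sup>2 + 8 * (\<Sum>m=1..N. (-1) ^ m * q ^ m / (1 + q ^ m)\<^sup>2 / (P\<^sub>N\<^sub>+\<^sub>m * P\<^sub>N\<^sub>-\<^sub>m))\<close>.
  Tannery's theorem gives the limit, and expanding \<open>q ^ m / (1 + q ^ m)\<^sup>2\<close> and swapping the
  summations turns it into the Lambert series.
\<close>

section \<open>Lagrange interpolation and the finite identity for the partial products\<close>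

text \<open>The interpolant on the right also has degree below the number of nodes and agrees with
  \<open>p\<close> at every node, so the two polynomials coincide.\<close>

lemma poly_eq_Lagrange_sum:
  fixes p :: "'a :: field poly" and x :: "'b \<Rightarrow> 'a"
  assumes fin: "finite S" and inj: "inj_on x S" and deg: "degree p < card S"
  shows "poly p y = (\<Sum>i\<in>S. poly p (x i) * (\<Prod>j\<in>S - {i}. (y - x j) / (x i - x j)))"
proof -
  define l where "l i = (\<Prod>j\<in>S - {i}. [:- x j / (x i - x j), 1 / (x i - x j):])" for i
  define L where "L = (\<Sum>i\<in>S. smult (poly p (x i)) (l i))"
  have poly_l: "poly (l i) z = (\<Prod>j\<in>S - {i}. (z - x j) / (x i - x j))" for i z
    unfolding l_def poly_prod by (intro prod.cong refl) (simp add: diff_divide_distrib)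
  have degree_l: "degree (l i) \<le> card S - 1" if "i \<in> S" for i
  proof -
    have "degree (l i) \<le> (\<Sum>j\<in>S - {i}. degree [:- x j / (x i - x j), 1 / (x i - x j):])"
      unfolding l_def using fin by (intro degree_prod_sum_le[unfolded o_def]) auto
    also have "\<dots> \<le> (\<Sum>j\<in>S - {i}. 1)"
      by (intro sum_mono) auto
    finally show ?thesis using that fin by simp
  qed
  have "degree L \<le> card S - 1"
    unfolding L_def using degree_l fin
    by (intro degree_sum_le) (auto intro: order_trans[OF degree_smult_le])
  \<comment> \<open>The assumption on \<open>degree p\<close> forces \<open>card S > 0\<close>, so
    the truncated subtraction \<open>card S - 1\<close> is a genuine predecessor.\<close>
  then have degree_L: "degree L < card S"
    using deg by simp
  have "p = L"
  proof (rule poly_eqI_degree[where A = "x ` S"])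
    fix z assume "z \<in> x ` S"
    then obtain k where k: "k \<in> S" and z: "z = x k" by auto
    have "poly (l i) (x k) = (if i = k then 1 else 0)" if "i \<in> S" for i
    proof (cases "i = k")
      case True
      have "(x k - x j) / (x k - x j) = 1" if "j \<in> S - {k}" for j
        using that k inj_onD[OF inj, of k j] by auto
      then show ?thesis using True by (simp add: poly_l)
    next
      case False
      then show ?thesis using k fin by (auto simp: poly_l intro!: prod_zero bexI[of _ k])
    qed
    then have "poly L z = (\<Sum>i\<in>S. poly p (x i) * (if i = k then 1 else 0))"
      by (simp add: L_def poly_sum z)
    also have "\<dots> = (\<Sum>i\<in>S. if i = k then poly p (x i) else 0)"
      by (intro sum.cong) auto
    also have "\<dots> = poly p z"
      using k fin z by (simp add: sum.delta)
    finally show "poly p z = poly L z" by simp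
  qed (use deg degree_L card_image[OF inj] in auto)
  then have "poly p y = poly L y" by simp
  then show ?thesis by (simp add: L_def poly_sum poly_l)
qed

text \<open>This is the partial product \<open>P\<^sub>N\<close> of the overview. In the limit it is
  Gauss's product for the theta series with terms \<open>(-1) ^ n * q ^ (n ^ 2)\<close>,
  \<open>n\<close> running over all integers.\<close>

definition phi_prod :: "'a :: field \<Rightarrow> nat \<Rightarrow> 'a" where
  "phi_prod q n = (\<Prod>k=1..n. (1 - q ^ k) / (1 + q ^ k))"

lemma power_neq_one_of_norm_less_one:
  fixes q :: "'a :: real_normed_div_algebra"
  assumes "norm q < 1" "k > 0"
  shows "1 - q ^ k \<noteq> 0" "1 + q ^ k \<noteq> 0"
proof -
  have "norm (q ^ k) < 1"
    using assms by (simp add: norm_power power_less_one_iff)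
  then show "1 - q ^ k \<noteq> 0" "1 + q ^ k \<noteq> 0"
    by (metis eq_iff_diff_eq_0 less_irrefl norm_one)
       (metis \<open>norm (q ^ k) < 1\<close> add_eq_0_iff less_irrefl norm_minus_cancel norm_one)
qed

lemma phi_prod_nonzero:
  fixes q :: "'a :: real_normed_field"
  assumes "norm q < 1"
  shows "phi_prod q n \<noteq> 0"
  using power_neq_one_of_norm_less_one[OF assms] by (auto simp: phi_prod_def)

text \<open>For \<open>j < i\<close> the power \<open>q ^ j\<close> cancels and leaves the negative
  of an inverted factor of \<open>phi_prod\<close> at \<open>k = i - j\<close>; these
  \<open>i\<close> factors produce the sign. For \<open>j > i\<close> the power \<open>q ^ i\<close>
  cancels and leaves the inverted factor at \<open>k = j - i\<close>.\<close>

lemma prod_other_nodes: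
  fixes q :: "'a :: real_normed_field"
  assumes q: "norm q < 1" "q \<noteq> 0" and i: "i \<le> n"
  shows "(\<Prod>j\<in>{..n} - {i}. (q ^ i + q ^ j) / (q ^ i - q ^ j)) =
           (-1) ^ i / (phi_prod q i * phi_prod q (n - i))"
proof -
  note nz = power_neq_one_of_norm_less_one[OF q(1)]
  have "(\<Prod>j\<in>{..<i}. (q ^ i + q ^ j) / (q ^ i - q ^ j)) =
          (\<Prod>k\<in>{1..i}. - ((1 + q ^ k) / (1 - q ^ k)))"
  proof (rule prod.reindex_bij_witness[where i = "\<lambda>k. i - k" and j = "\<lambda>j. i - j"])
    fix j assume "j \<in> {..<i}"
    then have "q ^ i = q ^ j * q ^ (i - j)" and "i - j > 0"
      by (simp_all flip: power_add)
    then show "- ((1 + q ^ (i - j)) / (1 - q ^ (i - j))) = (q ^ i + q ^ j) / (q ^ i - q ^ j)"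
      using nz(1)[of "i - j"] q(2) by (simp add: divide_simps) (simp add: algebra_simps)
  qed auto
  also have "\<dots> = (-1) ^ i / phi_prod q i"
    by (simp add: phi_prod_def prod_uminus prod_dividef)
  finally have low: "(\<Prod>j\<in>{..<i}. (q ^ i + q ^ j) / (q ^ i - q ^ j)) = (-1) ^ i / phi_prod q i" .
  have "(\<Prod>j\<in>{i<..n}. (q ^ i + q ^ j) / (q ^ i - q ^ j)) =
          (\<Prod>k\<in>{1..n - i}. (1 + q ^ k) / (1 - q ^ k))"
  proof (rule prod.reindex_bij_witness[where i = "\<lambda>k. i + k" and j = "\<lambda>j. j - i"])
    fix j assume "j \<in> {i<..n}"
    then have "q ^ j = q ^ i * q ^ (j - i)" and "j - i > 0"
      by (simp_all flip: power_add)
    then show "(1 + q ^ (j - i)) / (1 - q ^ (j - i)) = (q ^ i + q ^ j) / (q ^ i - q ^ j)"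
      using nz(1)[of "j - i"] q(2) by (simp add: divide_simps) (simp add: algebra_simps)
  qed auto
  also have "\<dots> = 1 / phi_prod q (n - i)"
    by (simp add: phi_prod_def prod_dividef)
  finally have high: "(\<Prod>j\<in>{i<..n}. (q ^ i + q ^ j) / (q ^ i - q ^ j)) = 1 / phi_prod q (n - i)" .
  have "{..n} - {i} = {..<i} \<union> {i<..n}"
    using i by auto
  moreover have "{..<i} \<inter> {i<..n} = {}"
    by auto
  ultimately show ?thesis
    using low high by (simp add: prod.union_disjoint)
qed

lemma inj_power_of_norm_less_one:
  fixes q :: "'a :: real_normed_field"
  assumes "norm q < 1" "q \<noteq> 0"
  shows "inj (\<lambda>i :: nat. q ^ i)"
proof (rule linorder_injI)
  fix i j :: nat assume "i < j"
  then have "q ^ j = q ^ i * q ^ (j - i)" and "j - i > 0"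
    by (simp_all flip: power_add)
  then show "q ^ i \<noteq> q ^ j"
    using power_neq_one_of_norm_less_one(1)[OF assms(1), of "j - i"] assms(2) by auto
qed

text \<open>Lagrange interpolation of \<open>\<Prod>j\<noteq>N. (y + q ^ j)\<close> at the nodes \<open>q ^ i\<close>, \<open>i \<le> 2 * N\<close>, evaluated at
  \<open>y = - q ^ N\<close>.\<close>

lemma phi_prod_square_sum:
  fixes q :: "'a :: real_normed_field"
  assumes q: "norm q < 1" "q \<noteq> 0"
  shows "(-1) ^ N * phi_prod q N ^ 2 =
    (\<Sum>i\<le>2 * N. (-1) ^ i / (phi_prod q i * phi_prod q (2 * N - i)) *
       (4 * (q ^ (N + i) / (q ^ N + q ^ i) ^ 2)))"
proof -
  define S where "S = {..2 * N}"
  define p where "p = (\<Prod>j\<in>S - {N}. [:q ^ j, 1:])"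
  \<comment> \<open>\<open>D\<close> is the value of \<open>p\<close> at the middle node
    \<open>q ^ N\<close>. It turns up as a factor of the left side and of every Lagrange term, and
    is cancelled at the end.\<close>
  define D where "D = (\<Prod>j\<in>S - {N}. (q ^ N + q ^ j))"
  have S: "finite S" "N \<in> S" "card (S - {N}) = 2 * N"
    by (simp_all add: S_def)
  have nz: "q ^ i + q ^ j \<noteq> 0" for i j :: nat
  proof (induction i j rule: linorder_wlog)
    case (le i j)
    have "q ^ i + q ^ j = q ^ i * (1 + q ^ (j - i))"
      using le by (simp add: algebra_simps flip: power_add)
    moreover have "1 + q ^ (j - i) \<noteq> 0"
      using power_neq_one_of_norm_less_one(2)[OF q(1), of "j - i"] le by (cases "j = i") auto
    ultimately show ?case using q(2) by simp
  qed (simp add: add.commute)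
  then have "D \<noteq> 0"
    using S by (simp add: D_def)
  have poly_p: "poly p y = (\<Prod>j\<in>S - {N}. (y + q ^ j))" for y
    by (simp add: p_def poly_prod add.commute)
  have "degree p \<le> (\<Sum>j\<in>S - {N}. degree [:q ^ j, 1:])"
    unfolding p_def using S by (intro degree_prod_sum_le[unfolded o_def]) auto
  then have "degree p < card S"
    using S by (simp add: S_def)
  moreover have "inj_on (\<lambda>i. q ^ i) S"
    using inj_power_of_norm_less_one[OF q] by (rule inj_on_subset) simp
  ultimately have "poly p (- (q ^ N)) =
      (\<Sum>i\<in>S. poly p (q ^ i) * (\<Prod>j\<in>S - {i}. (- (q ^ N) - q ^ j) / (q ^ i - q ^ j)))"
    using S by (intro poly_eq_Lagrange_sum)
  moreover have "poly p (- (q ^ N)) = D * ((-1) ^ N * phi_prod q N ^ 2)"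
  proof -
    have "poly p (- (q ^ N)) = (\<Prod>j\<in>S - {N}. (-1) * (q ^ N - q ^ j))"
      unfolding poly_p by (intro prod.cong) auto
    \<comment> \<open>Deleting one of the \<open>2 * N + 1\<close> nodes leaves an even number of
      factors, so the signs cancel; the same happens in \<open>4\<close> below.\<close>
    also have "\<dots> = (\<Prod>j\<in>S - {N}. q ^ N - q ^ j)"
      unfolding prod.distrib by (simp add: S)
    also have "\<dots> = D / (\<Prod>j\<in>S - {N}. (q ^ N + q ^ j) / (q ^ N - q ^ j))"
      using \<open>D \<noteq> 0\<close> by (simp add: D_def prod_dividef)
    also have "\<dots> = D * ((-1) ^ N * phi_prod q N ^ 2)"
      unfolding S_def using prod_other_nodes[OF q, of N "2 * N"]
      by (cases "even N") (auto simp: power2_eq_square)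
    finally show ?thesis .
  qed
  moreover have "poly p (q ^ i) * (\<Prod>j\<in>S - {i}. (- (q ^ N) - q ^ j) / (q ^ i - q ^ j)) =
      D * ((-1) ^ i / (phi_prod q i * phi_prod q (2 * N - i)) *
       (4 * (q ^ (N + i) / (q ^ N + q ^ i) ^ 2)))" if "i \<in> S" for i
  proof -
    \<comment> \<open>Both sides are the product of \<open>q ^ i + q ^ j\<close> over all of
      \<open>S\<close>, with the factor at \<open>N\<close> split off on the left and the factor at
      \<open>i\<close> on the right. Fact \<open>2\<close> does the same for
      \<open>q ^ N + q ^ j\<close>.\<close>
    have 1: "poly p (q ^ i) * (q ^ i + q ^ N) = (\<Prod>j\<in>S - {i}. (q ^ i + q ^ j)) * (2 * q ^ i)"
      using prod.remove[OF S(1,2), of "\<lambda>j. q ^ i + q ^ j"]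
        prod.remove[OF S(1) that, of "\<lambda>j. q ^ i + q ^ j"] by (simp add: poly_p mult_ac)
    have 2: "(\<Prod>j\<in>S - {i}. (q ^ N + q ^ j)) * (q ^ N + q ^ i) = D * (2 * q ^ N)"
      using prod.remove[OF S(1,2), of "\<lambda>j. q ^ N + q ^ j"]
        prod.remove[OF S(1) that, of "\<lambda>j. q ^ N + q ^ j"] by (simp add: D_def mult_ac)
    have 3: "(\<Prod>j\<in>S - {i}. (q ^ i + q ^ j)) / (\<Prod>j\<in>S - {i}. (q ^ i - q ^ j)) =
        (-1) ^ i / (phi_prod q i * phi_prod q (2 * N - i))"
      using prod_other_nodes[OF q, of i "2 * N"] that by (simp add: S_def prod_dividef)
    have "card (S - {i}) = 2 * N"
      using that by (simp add: S_def)
    moreover have "(\<Prod>j\<in>S - {i}. (- (q ^ N) - q ^ j)) = (\<Prod>j\<in>S - {i}. (-1) * (q ^ N + q ^ j))"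
      by (intro prod.cong) auto
    ultimately have 4: "(\<Prod>j\<in>S - {i}. (- (q ^ N) - q ^ j)) = (\<Prod>j\<in>S - {i}. (q ^ N + q ^ j))"
      unfolding prod.distrib by simp
    have "poly p (q ^ i) * (\<Prod>j\<in>S - {i}. (- (q ^ N) - q ^ j) / (q ^ i - q ^ j)) =
        ((\<Prod>j\<in>S - {i}. (q ^ i + q ^ j)) * (2 * q ^ i) / (q ^ i + q ^ N)) * (D * (2 * q ^ N) / (q ^ N + q ^ i))
          / (\<Prod>j\<in>S - {i}. (q ^ i - q ^ j))"
      unfolding prod_dividef 4 1[symmetric] 2[symmetric] using nz by simp
    also have "\<dots> = D * (((\<Prod>j\<in>S - {i}. (q ^ i + q ^ j)) / (\<Prod>j\<in>S - {i}. (q ^ i - q ^ j))) *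
        (4 * (q ^ (N + i) / (q ^ N + q ^ i) ^ 2)))"
      by (simp add: power_add power2_eq_square add.commute mult_ac)
    finally show ?thesis unfolding 3 .
  qed
  ultimately have "D * ((-1) ^ N * phi_prod q N ^ 2) = D * (\<Sum>i\<in>S.
      (-1) ^ i / (phi_prod q i * phi_prod q (2 * N - i)) *
       (4 * (q ^ (N + i) / (q ^ N + q ^ i) ^ 2)))"
    by (simp add: sum_distrib_left)
  then show ?thesis
    using \<open>D \<noteq> 0\<close> unfolding S_def mult_cancel_left by blast
qed

text \<open>In \<open>phi_prod_square_sum\<close> the weight of a term depends only on the distance
  of \<open>i\<close> from \<open>N\<close>, so the terms at \<open>N + m\<close> and
  \<open>N - m\<close> agree and the factor 4 becomes 8. At \<open>i = N\<close> the weight is 1,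
  which gives the isolated term. The common sign \<open>(-1) ^ N\<close> cancels.\<close>

lemma phi_prod_square:
  fixes q :: "'a :: real_normed_field"
  assumes q: "norm q < 1" "q \<noteq> 0"
  shows "phi_prod q N ^ 2 = 1 / phi_prod q N ^ 2 +
    8 * (\<Sum>m=1..N. (-1) ^ m * q ^ m / (1 + q ^ m) ^ 2 / (phi_prod q (N + m) * phi_prod q (N - m)))"
proof -
  define g where "g i = (-1) ^ i / (phi_prod q i * phi_prod q (2 * N - i)) *
       (4 * (q ^ (N + i) / (q ^ N + q ^ i) ^ 2))" for i
  define h where "h m = (-1) ^ m * q ^ m / (1 + q ^ m) ^ 2 /
    (phi_prod q (N + m) * phi_prod q (N - m))" for m
  have cancel: "a * (a * b) / (a * c) ^ 2 = b / c ^ 2" if "a \<noteq> 0" for a b c :: 'a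
    using that by (simp add: power_mult_distrib power2_eq_square)
  have up: "g (N + m) = (-1) ^ N * 4 * h m" if "m \<in> {1..N}" for m
  proof -
    have "q ^ (N + (N + m)) / (q ^ N + q ^ (N + m)) ^ 2 = q ^ m / (1 + q ^ m) ^ 2"
    proof -
      have "q ^ N + q ^ (N + m) = q ^ N * (1 + q ^ m)"
        by (simp add: power_add algebra_simps)
      then show ?thesis
        using q(2) cancel[of "q ^ N" "q ^ m" "1 + q ^ m"] by (simp add: power_add)
    qed
    moreover have "2 * N - (N + m) = N - m" by simp
    moreover have "(-1) ^ (N + m) = ((-1) ^ N * (-1) ^ m :: 'a)"
      by (simp add: power_add)
    ultimately show ?thesis
      by (simp add: g_def h_def mult_ac)
  qed
  have down: "g (N - m) = (-1) ^ N * 4 * h m" if m: "m \<in> {1..N}" for m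
  proof -
    have N: "q ^ N = q ^ (N - m) * q ^ m" "(-1) ^ N = ((-1) ^ (N - m) * (-1) ^ m :: 'a)"
      using m by (simp_all flip: power_add)
    have "q ^ (N + (N - m)) / (q ^ N + q ^ (N - m)) ^ 2 = q ^ m / (1 + q ^ m) ^ 2"
    proof -
      have "q ^ N + q ^ (N - m) = q ^ (N - m) * (1 + q ^ m)"
        by (simp add: N algebra_simps)
      then show ?thesis
        using q(2) cancel[of "q ^ (N - m)" "q ^ m" "1 + q ^ m"] by (simp add: power_add N mult_ac)
    qed
    moreover have "2 * N - (N - m) = N + m" using m by simp
    moreover have "(-1) ^ (N - m) = ((-1) ^ N * (-1) ^ m :: 'a)"
      by (simp add: N)
    ultimately show ?thesis
      by (simp add: g_def h_def mult_ac)
  qed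
  have mid: "g N = (-1) ^ N * (1 / phi_prod q N ^ 2)"
  proof -
    have "2 * N - N = N" and "q ^ N + q ^ N = 2 * q ^ N" by simp_all
    then show ?thesis
      using q(2) by (simp add: g_def power_add power2_eq_square)
  qed
  have "(-1) ^ N * phi_prod q N ^ 2 = (\<Sum>i\<le>2 * N. g i)"
    unfolding g_def by (rule phi_prod_square_sum[OF q])
  also have "{..2 * N} = insert N ({..<N} \<union> {N<..2 * N})"
    by auto
  also have "(\<Sum>i\<in>\<dots>. g i) = g N + ((\<Sum>i\<in>{..<N}. g i) + (\<Sum>i\<in>{N<..2 * N}. g i))"
  proof -
    have "{..<N} \<inter> {N<..2 * N} = {}" by auto
    then show ?thesis by (simp add: sum.union_disjoint)
  qed
  also have "(\<Sum>i\<in>{..<N}. g i) = (\<Sum>m=1..N. (-1) ^ N * 4 * h m)"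
    by (rule sum.reindex_bij_witness[where i = "\<lambda>m. N - m" and j = "\<lambda>i. N - i"])
       (auto simp flip: down)
  also have "(\<Sum>i\<in>{N<..2 * N}. g i) = (\<Sum>m=1..N. (-1) ^ N * 4 * h m)"
  proof (rule sum.reindex_bij_witness[where i = "\<lambda>m. N + m" and j = "\<lambda>i. i - N"])
    fix i assume "i \<in> {N<..2 * N}"
    then have "i - N \<in> {1..N}" and "N + (i - N) = i" by auto
    then show "(-1) ^ N * 4 * h (i - N) = g i"
      using up[of "i - N"] by presburger
  qed auto
  finally have "(-1) ^ N * phi_prod q N ^ 2 =
      (-1) ^ N * (1 / phi_prod q N ^ 2 + 8 * (\<Sum>m=1..N. h m))"
    unfolding mid sum_distrib_left[symmetric] by (simp add: algebra_simps)
  then show ?thesis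
    unfolding h_def by simp
qed

section \<open>Limits of the products\<close>

lemma prod_one_minus_power_LIMSEQ:
  assumes "norm q < 1" "n > 0"
  shows "(\<lambda>N. \<Prod>k=1..N. 1 - q ^ (n * k)) \<longlonglongrightarrow> euler_f n q" and "euler_f n q \<noteq> 0"
proof -
  \<comment> \<open>The product behind \<open>euler_f\<close> starts at \<open>k = 0\<close>, so
    \<open>1 + z k\<close> is the factor \<open>1 - q ^ (n * Suc k)\<close> of the products indexed
    from 1.\<close>
  define z where "z k = - (q ^ n * (q ^ n) ^ k)" for k :: nat
  have norm: "norm (q ^ n) < 1"
    using assms by (simp add: norm_power power_less_one_iff)
  have nz: "1 + z k \<noteq> 0" for k
    using power_neq_one_of_norm_less_one(1)[OF norm, of "Suc k"] by (simp add: z_def)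
  have "summable (\<lambda>k. norm (z k))"
    using norm by (auto simp: z_def norm_mult norm_power intro!: summable_mult summable_geometric)
  then have conv: "convergent_prod (\<lambda>k. 1 + z k)"
    using nz by (intro summable_imp_convergent_prod_complex) (auto simp: add_eq_0_iff)
  have f: "euler_f n q = prodinf (\<lambda>k. 1 + z k)"
    by (simp add: euler_f_def qpochhammer_inf_def z_def)
  show "euler_f n q \<noteq> 0"
    unfolding f using conv nz by (rule prodinf_nonzero)
  have "(\<Prod>k=1..Suc N. 1 - q ^ (n * k)) = (\<Prod>k\<le>N. 1 + z k)" for N
    by (rule prod.reindex_bij_witness[where i = Suc and j = "\<lambda>k. k - 1"])
       (auto simp: z_def algebra_simps simp flip: power_mult power_add)
  then have "(\<lambda>N. \<Prod>k=1..Suc N. 1 - q ^ (n * k)) \<longlonglongrightarrow> euler_f n q"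
    using convergent_prod_LIMSEQ[OF conv] by (simp only: f)
  then show "(\<lambda>N. \<Prod>k=1..N. 1 - q ^ (n * k)) \<longlonglongrightarrow> euler_f n q"
    by (rule LIMSEQ_imp_Suc)
qed

text \<open>Euler's factorization \<open>1 + q ^ k = (1 - q ^ (2 * k)) / (1 - q ^ k)\<close>,
  applied factor by factor before passing to the limit.\<close>

lemma prod_one_plus_power_LIMSEQ:
  assumes "norm q < 1"
  shows "(\<lambda>N. \<Prod>k=1..N. 1 + q ^ k) \<longlonglongrightarrow> euler_f 2 q / euler_f 1 q"
proof -
  have "(\<Prod>k=1..N. 1 + q ^ k) = (\<Prod>k=1..N. 1 - q ^ (2 * k)) / (\<Prod>k=1..N. 1 - q ^ (1 * k))" for N
    unfolding prod_dividef[symmetric]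
  proof (intro prod.cong refl)
    fix k assume "k \<in> {1..N}"
    then have "1 - q ^ k \<noteq> 0"
      using power_neq_one_of_norm_less_one(1)[OF assms, of k] by simp
    then show "1 + q ^ k = (1 - q ^ (2 * k)) / (1 - q ^ (1 * k))"
      by (simp add: field_simps power_mult power2_eq_square flip: power_mult_distrib power_add mult_2)
  qed
  then show ?thesis
    by (simp only:) (intro tendsto_divide prod_one_minus_power_LIMSEQ assms zero_less_one pos2)
qed

lemma phi_prod_LIMSEQ:
  assumes "norm q < 1"
  shows "phi_prod q \<longlonglongrightarrow> euler_f 1 q ^ 2 / euler_f 2 q"
proof -
  have "phi_prod q = (\<lambda>N. (\<Prod>k=1..N. 1 - q ^ (1 * k)) / (\<Prod>k=1..N. 1 + q ^ k))"
    by (simp add: fun_eq_iff phi_prod_def prod_dividef)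
  moreover have "(\<lambda>N. (\<Prod>k=1..N. 1 - q ^ (1 * k)) / (\<Prod>k=1..N. 1 + q ^ k)) \<longlonglongrightarrow>
      euler_f 1 q / (euler_f 2 q / euler_f 1 q)"
    using assms prod_one_minus_power_LIMSEQ(2)[OF assms]
    by (intro tendsto_divide prod_one_minus_power_LIMSEQ prod_one_plus_power_LIMSEQ) auto
  ultimately show ?thesis
    by (simp add: power2_eq_square)
qed

section \<open>Passage to the limit in the finite identity\<close>

text \<open>Supplies the majorant for Tannery's theorem: by the reverse triangle inequality
  \<open>norm (1 + q ^ Suc m)\<close> is at least \<open>1 - norm q\<close>, uniformly in
  \<open>m\<close>.\<close>

lemma norm_lambert_term_le:
  fixes q :: complex
  assumes "norm q < 1"
  shows "norm (c * q ^ Suc m / (1 + q ^ Suc m) ^ 2) \<le> norm c * (norm q ^ Suc m / (1 - norm q) ^ 2)"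
proof -
  have "norm q ^ Suc m \<le> norm q ^ 1"
    using assms by (intro power_decreasing) auto
  then have "1 - norm q \<le> 1 - norm (q ^ Suc m)"
    by (simp add: norm_mult norm_power)
  also have "\<dots> \<le> norm (1 + q ^ Suc m)"
    using norm_diff_ineq[of 1 "q ^ Suc m"] by simp
  finally have "(1 - norm q) ^ 2 \<le> norm (1 + q ^ Suc m) ^ 2"
    using assms by (intro power_mono) auto
  then have "norm q ^ Suc m / norm (1 + q ^ Suc m) ^ 2 \<le> norm q ^ Suc m / (1 - norm q) ^ 2"
    using assms by (intro divide_left_mono mult_pos_pos) auto
  then have "norm c * (norm q ^ Suc m / norm (1 + q ^ Suc m) ^ 2) \<le>
      norm c * (norm q ^ Suc m / (1 - norm q) ^ 2)"
    by (intro mult_left_mono) auto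
  then show ?thesis
    by (simp add: norm_mult norm_divide norm_power)
qed

lemma summable_lambert_bound:
  fixes r :: real
  assumes "0 \<le> r" "r < 1"
  shows "summable (\<lambda>m. r ^ Suc m / (1 - r) ^ 2)"
proof -
  have "summable (\<lambda>m. r ^ m * (r / (1 - r) ^ 2))"
    using assms by (intro summable_mult2 summable_geometric) auto
  then show ?thesis by (simp add: mult_ac)
qed

text \<open>As \<open>N\<close> grows, every partial product in \<open>phi_prod_square\<close> tends
  to the same nonzero \<open>P\<close>, so the identity becomes
  \<open>P ^ 2 = 1 / P ^ 2 + 8 / P ^ 2 * (\<Sum>m. b m)\<close>. Multiplying by \<open>P ^ 2\<close>
  gives the claim.\<close>

lemma euler_f_quartic_eq_alternating_series:
  assumes q: "norm q < 1" "q \<noteq> 0"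
  shows "(euler_f 1 q ^ 2 / euler_f 2 q) ^ 4 =
    1 + 8 * (\<Sum>m. (-1) ^ Suc m * q ^ Suc m / (1 + q ^ Suc m) ^ 2)"
proof -
  define P where "P = euler_f 1 q ^ 2 / euler_f 2 q"
  have P: "phi_prod q \<longlonglongrightarrow> P" "P \<noteq> 0"
    using phi_prod_LIMSEQ[OF q(1)] prod_one_minus_power_LIMSEQ(2)[OF q(1)] by (auto simp: P_def)
  define b where "b m = (-1) ^ Suc m * q ^ Suc m / (1 + q ^ Suc m) ^ 2" for m
  \<comment> \<open>Padding by zero turns the finite sum into a series over all \<open>m\<close>.
    Since \<open>b m\<close> carries the exponent \<open>Suc m\<close>, the condition
    \<open>m < N\<close> is exactly what keeps \<open>N - Suc m\<close> from being
    truncated.\<close>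
  define a where "a m N = (if m < N then
    b m / (phi_prod q (N + Suc m) * phi_prod q (N - Suc m)) else 0)" for m N
  \<comment> \<open>The reciprocals converge because \<open>P\<close> is nonzero; their bound
    \<open>B\<close> makes the majorant independent of \<open>N\<close>.\<close>
  have "Bseq (\<lambda>n. 1 / phi_prod q n)"
    using P by (intro convergent_imp_Bseq convergentI[of _ "1 / P"] tendsto_intros)
  then obtain B where B: "B > 0" "\<And>n. norm (1 / phi_prod q n) \<le> B"
    unfolding Bseq_def by auto
  have b: "norm (b m) \<le> norm q ^ Suc m / (1 - norm q) ^ 2" for m
    using norm_lambert_term_le[OF q(1), of "(-1) ^ Suc m" m] by (simp add: b_def norm_power)
  have sum_bound: "summable (\<lambda>m. norm q ^ Suc m / (1 - norm q) ^ 2)"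
    using q by (intro summable_lambert_bound) auto
  have "(\<lambda>N. \<Sum>m. a m N) \<longlonglongrightarrow> (\<Sum>m. b m / (P * P))"
  proof (rule tannerys_theorem[THEN conjunct2, THEN conjunct2])
    fix m
    have "(\<lambda>N. phi_prod q (N + Suc m)) \<longlonglongrightarrow> P"
      using P(1) by (rule LIMSEQ_ignore_initial_segment)
    moreover have "(\<lambda>N. phi_prod q (N - Suc m)) \<longlonglongrightarrow> P"
      using P(1) by (rule filterlim_compose) (rule filterlim_minus_const_nat_at_top)
    ultimately have "(\<lambda>N. b m / (phi_prod q (N + Suc m) * phi_prod q (N - Suc m))) \<longlonglongrightarrow> b m / (P * P)"
      using P(2) by (intro tendsto_intros) auto
    moreover have "\<forall>\<^sub>F N in sequentially.
        b m / (phi_prod q (N + Suc m) * phi_prod q (N - Suc m)) = a m N"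
      using eventually_gt_at_top[of m] by eventually_elim (simp add: a_def)
    ultimately show "(\<lambda>N. a m N) \<longlonglongrightarrow> b m / (P * P)"
      by (rule Lim_transform_eventually)
  next
    have "norm (a m N) \<le> norm q ^ Suc m / (1 - norm q) ^ 2 * (B * B)" for m N
    proof (cases "m < N")
      case True
      then have "norm (a m N) = norm (b m) *
          (norm (1 / phi_prod q (N + Suc m)) * norm (1 / phi_prod q (N - Suc m)))"
        by (simp add: a_def norm_mult norm_divide)
      also have "\<dots> \<le> norm q ^ Suc m / (1 - norm q) ^ 2 * (B * B)"
        using b B by (intro mult_mono) auto
      finally show ?thesis .
    qed (use B in \<open>auto simp: a_def\<close>)
    then show "\<forall>\<^sub>F (m, N) in at_top \<times>\<^sub>F sequentially.
        norm (a m N) \<le> norm q ^ Suc m / (1 - norm q) ^ 2 * (B * B)"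
      by (simp add: case_prod_unfold)
    show "summable (\<lambda>m. norm q ^ Suc m / (1 - norm q) ^ 2 * (B * B))"
      using sum_bound by (rule summable_mult2)
  qed simp
  moreover have "(\<Sum>m. a m N) = (phi_prod q N ^ 2 - 1 / phi_prod q N ^ 2) / 8" for N
  proof -
    have "(\<Sum>m. a m N) = (\<Sum>m<N. a m N)"
      by (intro suminf_finite) (auto simp: a_def)
    also have "\<dots> = (\<Sum>m=1..N. (-1) ^ m * q ^ m / (1 + q ^ m) ^ 2 /
        (phi_prod q (N + m) * phi_prod q (N - m)))"
      by (rule sum.reindex_bij_witness[where i = "\<lambda>m. m - 1" and j = Suc])
         (auto simp: a_def b_def)
    also have "\<dots> = (phi_prod q N ^ 2 - 1 / phi_prod q N ^ 2) / 8"
    proof -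
      have "x = (b - c) / 8" if "b = c + 8 * x" for b c x :: complex
        using that by simp
      then show ?thesis
        using phi_prod_square[OF q, of N] by blast
    qed
    finally show ?thesis .
  qed
  ultimately have "(\<lambda>N. (phi_prod q N ^ 2 - 1 / phi_prod q N ^ 2) / 8) \<longlonglongrightarrow> (\<Sum>m. b m / (P * P))"
    by simp
  moreover have "(\<lambda>N. (phi_prod q N ^ 2 - 1 / phi_prod q N ^ 2) / 8) \<longlonglongrightarrow> (P ^ 2 - 1 / P ^ 2) / 8"
    using P by (intro tendsto_intros) auto
  ultimately have "(\<Sum>m. b m / (P * P)) = (P ^ 2 - 1 / P ^ 2) / 8"
    by (rule LIMSEQ_unique)
  moreover have "summable b"
    using sum_bound b by (rule summable_comparison_test')
  then have "(\<Sum>m. b m / (P * P)) = (\<Sum>m. b m) / (P * P)"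
    by (rule suminf_divide)
  ultimately have "P ^ 4 = 1 + 8 * (\<Sum>m. b m)"
    using P(2) by (simp add: field_simps power2_eq_square power4_eq_xxxx)
  then show ?thesis
    unfolding P_def b_def .
qed

section \<open>Rearranging the Lambert series\<close>

lemma geometric_deriv_has_sum:
  fixes z :: "'a :: {real_normed_field, banach}"
  assumes "norm z < 1"
  shows "((\<lambda>k. of_nat (Suc k) * z ^ Suc k) has_sum z / (1 - z) ^ 2) UNIV"
proof (rule norm_summable_imp_has_sum)
  \<comment> \<open>The fresh type variable lets the fact be used twice: for \<open>z\<close>
    itself, and for the real number \<open>norm z\<close> to get absolute convergence.\<close>
  have *: "(\<lambda>k. of_nat (Suc k) * w ^ Suc k) sums (w / (1 - w) ^ 2)"
    if "norm w < 1" for w :: "'b :: {real_normed_field, banach}"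
    using sums_mult[OF geometric_deriv_sums[OF that], of w] by (simp add: mult_ac)
  show "(\<lambda>k. of_nat (Suc k) * z ^ Suc k) sums (z / (1 - z) ^ 2)"
    using * assms .
  have "norm (norm z) < 1" using assms by simp
  from sums_summable[OF *[OF this]]
  show "summable (\<lambda>k. norm (of_nat (Suc k) * z ^ Suc k))"
    by (simp add: norm_mult norm_power del: of_nat_Suc)
qed

text \<open>Both sides are the double sum of \<open>(-1) ^ (j + k) * k * q ^ (j * k)\<close> over \<open>j, k \<ge> 1\<close>.\<close>

lemma alternating_lambert_swap:
  fixes q :: complex
  assumes "norm q < 1"
  shows "(\<lambda>k. (-1) ^ k * of_nat (Suc k) * q ^ Suc k / (1 + q ^ Suc k)) sums
    - (\<Sum>m. (-1) ^ Suc m * q ^ Suc m / (1 + q ^ Suc m) ^ 2)"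
proof -
  define r where "r = norm q"
  have r: "0 \<le> r" "r < 1" using assms by (auto simp: r_def)
  \<comment> \<open>Both indices are shifted down by one, which leaves the parity of their sum, and
    hence the sign, unchanged.\<close>
  define f where "f = (\<lambda>(m, k). (-1) ^ m * ((-1) ^ k * (of_nat (Suc k) * q ^ (Suc m * Suc k))))"
  have pow: "norm (z ^ Suc m) < 1" if "norm z < 1" for z :: complex and m
    using that by (simp add: norm_power power_less_one_iff del: power_Suc)
  have row: "((\<lambda>k. f (m, k)) has_sum - ((-1) ^ Suc m * q ^ Suc m / (1 + q ^ Suc m) ^ 2)) UNIV" for m
  proof -
    have "norm (- (q ^ Suc m)) < 1"
      using pow[OF assms] by (simp del: power_Suc)
    note has_sum_cmult_right[OF geometric_deriv_has_sum[OF this], of "- ((-1) ^ m)"]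
    moreover have "(\<lambda>k. - ((-1) ^ m) * (of_nat (Suc k) * (- (q ^ Suc m)) ^ Suc k)) = (\<lambda>k. f (m, k))"
    proof
      fix k
      have "(- (q ^ Suc m)) ^ Suc k = (-1) ^ Suc k * q ^ (Suc m * Suc k)"
        unfolding power_minus[of "q ^ Suc m"] power_mult ..
      then show "- ((-1) ^ m) * (of_nat (Suc k) * (- (q ^ Suc m)) ^ Suc k) = f (m, k)"
        by (simp add: f_def del: of_nat_Suc mult_Suc mult_Suc_right)
    qed
    ultimately show ?thesis by simp
  qed
  have col: "((\<lambda>m. f (m, k)) has_sum ((-1) ^ k * of_nat (Suc k) * q ^ Suc k / (1 + q ^ Suc k))) UNIV" for k
  proof -
    have "norm (- (q ^ Suc k)) < 1"
      using pow[OF assms] by (simp del: power_Suc)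
    then have "((\<lambda>m. (- (q ^ Suc k)) ^ m) has_sum 1 / (1 - - (q ^ Suc k))) UNIV"
      by (intro norm_summable_imp_has_sum geometric_sums) (auto simp: norm_power intro!: summable_geometric)
    from has_sum_cmult_right[OF this, of "(-1) ^ k * of_nat (Suc k) * q ^ Suc k"]
    have "((\<lambda>m. (-1) ^ k * of_nat (Suc k) * q ^ Suc k * (- (q ^ Suc k)) ^ m) has_sum
        ((-1) ^ k * of_nat (Suc k) * q ^ Suc k / (1 + q ^ Suc k))) UNIV"
      by simp
    moreover have "(\<lambda>m. (-1) ^ k * of_nat (Suc k) * q ^ Suc k * (- (q ^ Suc k)) ^ m) = (\<lambda>m. f (m, k))"
    proof
      fix m
      have "q ^ (Suc m * Suc k) = q ^ Suc k * (q ^ Suc k) ^ m"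
        by (metis mult.commute power_Suc power_mult)
      then show "(-1) ^ k * of_nat (Suc k) * q ^ Suc k * (- (q ^ Suc k)) ^ m = f (m, k)"
        unfolding f_def power_minus[of "q ^ Suc k"]
        by (simp add: mult_ac del: of_nat_Suc mult_Suc mult_Suc_right power_Suc)
    qed
    ultimately show ?thesis by simp
  qed
  \<comment> \<open>The norms in row \<open>m\<close> sum to
    \<open>r ^ Suc m / (1 - r ^ Suc m) ^ 2\<close>, and these row sums are dominated by the summable
    \<open>r ^ Suc m / (1 - r) ^ 2\<close>.\<close>
  have "f summable_on UNIV \<times> UNIV"
  proof (rule abs_summable_summable, rule summable_on_SigmaI)
    fix m :: nat
    have "norm (r ^ Suc m) < 1"
      using pow[OF assms, of m] by (simp add: r_def norm_power del: power_Suc)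
    from geometric_deriv_has_sum[OF this]
    show "((\<lambda>k. norm (f (m, k))) has_sum (r ^ Suc m / (1 - r ^ Suc m) ^ 2)) UNIV"
      by (simp add: f_def norm_mult norm_power r_def power_mult[symmetric] del: power_Suc of_nat_Suc)
  next
    show "(\<lambda>m. r ^ Suc m / (1 - r ^ Suc m) ^ 2) summable_on UNIV"
    proof (rule norm_summable_imp_summable_on, rule summable_comparison_test')
      show "summable (\<lambda>m. r ^ Suc m / (1 - r) ^ 2)"
        using r by (rule summable_lambert_bound)
      fix m :: nat
      have "r ^ Suc m \<le> r ^ 1"
        using r by (intro power_decreasing) auto
      then have "(1 - r) ^ 2 \<le> (1 - r ^ Suc m) ^ 2"
        using r by (intro power_mono) auto
      then have "r ^ Suc m / (1 - r ^ Suc m) ^ 2 \<le> r ^ Suc m / (1 - r) ^ 2"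
        using r by (intro divide_left_mono mult_pos_pos) (auto intro: less_le_trans[of _ "(1 - r)\<^sup>2"])
      then show "norm (norm (r ^ Suc m / (1 - r ^ Suc m) ^ 2)) \<le> r ^ Suc m / (1 - r) ^ 2"
        using r by simp
    qed
  qed auto
  then obtain S where S: "(f has_sum S) (UNIV \<times> UNIV)"
    by (auto simp: summable_on_def)
  \<comment> \<open>Both iterated sums equal \<open>S\<close>: rows are summed first here, columns
    first after the swap below.\<close>
  from sums_unique[OF sums_minus[OF has_sum_imp_sums[OF has_sum_SigmaD[OF S row]]]]
  have "- S = (\<Sum>m. (-1) ^ Suc m * q ^ Suc m / (1 + q ^ Suc m) ^ 2)"
    by (simp only: minus_minus)
  then have "S = - (\<Sum>m. (-1) ^ Suc m * q ^ Suc m / (1 + q ^ Suc m) ^ 2)"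
    by (rule minus_equation_iff[THEN iffD1, symmetric])
  moreover have "((\<lambda>(k, m). f (m, k)) has_sum S) (UNIV \<times> UNIV)"
    using S by (subst (asm) has_sum_swap)
  from has_sum_imp_sums[OF has_sum_SigmaD[OF this]] col
  have "(\<lambda>k. (-1) ^ k * of_nat (Suc k) * q ^ Suc k / (1 + q ^ Suc k)) sums S"
    by simp
  ultimately show ?thesis by simp
qed

section \<open>Generating functions over finite sets of positive integers\<close>

text \<open>For fixed \<open>k\<close>, the subsets containing \<open>k\<close> contribute
  \<open>w k * x k\<close> times the product of the other factors \<open>1 + x j\<close>. The
  induction obtains this by splitting the subsets according to whether they contain the new element
  \<open>s\<close>.\<close>

lemma sum_Pow_weighted_prod:
  fixes x w :: "'b \<Rightarrow> 'a :: field"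
  assumes "finite S" "\<And>k. k \<in> S \<Longrightarrow> 1 + x k \<noteq> 0"
  shows "(\<Sum>A\<in>Pow S. (\<Sum>k\<in>A. w k) * (\<Prod>k\<in>A. x k)) =
    (\<Prod>k\<in>S. 1 + x k) * (\<Sum>k\<in>S. w k * x k / (1 + x k))"
  using assms
proof (induction S rule: finite_induct)
  case (insert s S)
  define T where "T A = (\<Sum>k\<in>A. w k) * (\<Prod>k\<in>A. x k)" for A
  have prod: "(\<Sum>A\<in>Pow S. \<Prod>k\<in>A. x k) = (\<Prod>k\<in>S. 1 + x k)"
    using prod_add[OF insert.hyps(1), of x "\<lambda>_. 1"]
    by (simp add: add.commute)
  have "inj_on (insert s) (Pow S)"
    using insert.hyps by (auto simp: inj_on_def)
  then have "(\<Sum>A\<in>Pow (insert s S). T A) = (\<Sum>A\<in>Pow S. T A) + (\<Sum>A\<in>Pow S. T (insert s A))"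
    unfolding Pow_insert using insert.hyps
    by (subst sum.union_disjoint) (auto simp: sum.reindex)
  also have "(\<Sum>A\<in>Pow S. T (insert s A)) =
      (\<Sum>A\<in>Pow S. x s * T A + w s * x s * (\<Prod>k\<in>A. x k))"
  proof (intro sum.cong refl)
    fix A assume "A \<in> Pow S"
    then have "finite A" "s \<notin> A"
      using insert.hyps finite_subset by auto
    then show "T (insert s A) = x s * T A + w s * x s * (\<Prod>k\<in>A. x k)"
      by (simp add: T_def algebra_simps)
  qed
  also have "(\<Sum>A\<in>Pow S. T A) + (\<Sum>A\<in>Pow S. x s * T A + w s * x s * (\<Prod>k\<in>A. x k)) =
      (1 + x s) * (\<Sum>A\<in>Pow S. T A) + w s * x s * (\<Prod>k\<in>S. 1 + x k)"
    unfolding sum.distrib sum_distrib_left[symmetric] prod by (simp add: algebra_simps)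
  also have "(\<Sum>A\<in>Pow S. T A) = (\<Prod>k\<in>S. 1 + x k) * (\<Sum>k\<in>S. w k * x k / (1 + x k))"
    unfolding T_def using insert by auto
  finally have "(\<Sum>A\<in>Pow (insert s S). T A) =
      (1 + x s) * ((\<Prod>k\<in>S. 1 + x k) * (\<Sum>k\<in>S. w k * x k / (1 + x k))) +
      w s * x s * (\<Prod>k\<in>S. 1 + x k)" by simp
  moreover have "(1 + a) * (p * t) + v * p = (1 + a) * p * (v / (1 + a) + t)"
    if "1 + a \<noteq> 0" for a p t v :: 'a
    using that by (simp add: divide_simps) (simp add: algebra_simps)
  ultimately have "(\<Sum>A\<in>Pow (insert s S). T A) = (1 + x s) * (\<Prod>k\<in>S. 1 + x k) *
      (w s * x s / (1 + x s) + (\<Sum>k\<in>S. w k * x k / (1 + x k)))"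
    using insert.prems[of s] by simp
  then show ?case
    using insert.hyps by (simp add: T_def)
qed simp

lemma sum_Pow_weighted_power:
  fixes q :: "'a :: real_normed_field"
  assumes "norm q < 1"
  shows "(\<Sum>A\<in>Pow {1..M}. (\<Sum>k\<in>A. w k) * q ^ \<Sum>A) =
    (\<Prod>k=1..M. 1 + q ^ k) * (\<Sum>k=1..M. w k * q ^ k / (1 + q ^ k))"
  using sum_Pow_weighted_prod[of "{1..M}" "\<lambda>k. q ^ k" w]
    power_neq_one_of_norm_less_one(2)[OF assms]
  by (simp add: power_sum)

text \<open>Absolute summability is what later allows regrouping the sets by their total. It follows
  from a bound on all finite partial sums, after replacing \<open>w k\<close> by \<open>k\<close>
  and \<open>q\<close> by its norm.\<close>

lemma weighted_distinct_sets_abs_summable: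
  fixes q :: complex and w :: "nat \<Rightarrow> complex"
  assumes q: "norm q < 1" and w: "\<And>k. norm (w k) \<le> real k"
  shows "(\<lambda>A. norm ((\<Sum>k\<in>A. w k) * q ^ \<Sum>A)) summable_on Fpow {1..}"
proof -
  define r where "r = norm q"
  have r: "0 \<le> r" "r < 1" using q by (auto simp: r_def)
  define g where "g A = (\<Sum>k\<in>A. real k) * r ^ \<Sum>A" for A
  \<comment> \<open>The first factor bounds the product, through \<open>1 + t \<le> exp t\<close>
    and the geometric series; the second bounds the Lambert sum after its denominators are
    dropped.\<close>
  define C where "C = exp (1 / (1 - r)) * (r / (1 - r) ^ 2)"
  have "(\<Sum>A\<in>F. g A) \<le> C" if F: "finite F" "F \<subseteq> Fpow {1..}" for F
  proof -
    \<comment> \<open>A common bound \<open>M\<close> for all elements of the sets in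
      \<open>F\<close> embeds \<open>F\<close> in a full power set, where the closed formula
      applies.\<close>
    have "finite (\<Union>F)" using F by (auto simp: Fpow_def)
    then obtain M where "\<Union>F \<subseteq> {..M}"
      using finite_nat_iff_bounded_le by blast
    then have "F \<subseteq> Pow {1..M}"
      using F by (fastforce simp: Fpow_def)
    then have "(\<Sum>A\<in>F. g A) \<le> (\<Sum>A\<in>Pow {1..M}. g A)"
      using r by (intro sum_mono2) (auto simp: g_def intro!: mult_nonneg_nonneg sum_nonneg)
    also have "\<dots> = (\<Prod>k=1..M. 1 + r ^ k) * (\<Sum>k=1..M. real k * r ^ k / (1 + r ^ k))"
      unfolding g_def using r by (intro sum_Pow_weighted_power) auto
    also have "\<dots> \<le> C"
      unfolding C_def
    proof (intro mult_mono)
      have "(\<Prod>k=1..M. 1 + r ^ k) \<le> (\<Prod>k=1..M. exp (r ^ k))"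
        using r by (intro prod_mono) auto
      also have "\<dots> = exp (\<Sum>k=1..M. r ^ k)"
        by (simp add: exp_sum)
      also have "(\<Sum>k=1..M. r ^ k) \<le> (\<Sum>k. r ^ k)"
        using r by (intro sum_le_suminf summable_geometric) auto
      finally show "(\<Prod>k=1..M. 1 + r ^ k) \<le> exp (1 / (1 - r))"
        using r by (simp add: suminf_geometric)
      have "(\<Sum>k=1..M. real k * r ^ k / (1 + r ^ k)) \<le> (\<Sum>k=1..M. real k * r ^ k)"
      proof (intro sum_mono)
        fix k
        have "real k * r ^ k / (1 + r ^ k) \<le> real k * r ^ k / 1"
          using r by (intro divide_left_mono) (auto intro: add_pos_nonneg)
        then show "real k * r ^ k / (1 + r ^ k) \<le> real k * r ^ k" by simp
      qed
      also have "\<dots> = (\<Sum>k<M. real (Suc k) * r ^ Suc k)"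
        by (rule sum.reindex_bij_witness[where i = Suc and j = "\<lambda>k. k - 1"]) auto
      also have "\<dots> \<le> r / (1 - r) ^ 2"
      proof -
        have s: "(\<lambda>k. real (Suc k) * r ^ Suc k) sums (r / (1 - r) ^ 2)"
          using r geometric_deriv_has_sum[of r] by (intro has_sum_imp_sums) simp
        have "(\<Sum>k<M. real (Suc k) * r ^ Suc k) \<le> (\<Sum>k. real (Suc k) * r ^ Suc k)"
          using r by (intro sum_le_suminf sums_summable[OF s]) auto
        then show ?thesis unfolding sums_unique[OF s, symmetric] .
      qed
      finally show "(\<Sum>k=1..M. real k * r ^ k / (1 + r ^ k)) \<le> r / (1 - r) ^ 2" .
    qed (use r in \<open>auto intro!: sum_nonneg\<close>)
    finally show ?thesis .
  qed
  then have "(\<lambda>A. norm (g A)) summable_on Fpow {1..}"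
    using r unfolding abs_summable_iff_bdd_above
    by (intro bdd_aboveI2[of _ _ C]) (auto simp: g_def abs_mult sum_nonneg)
  then show ?thesis
  proof (rule Infinite_Sum.abs_summable_on_comparison_test)
    fix A :: "nat set"
    have "norm (\<Sum>k\<in>A. w k) \<le> (\<Sum>k\<in>A. real k)"
      using w by (intro order_trans[OF norm_sum] sum_mono) auto
    then show "norm ((\<Sum>k\<in>A. w k) * q ^ \<Sum>A) \<le> norm (g A)"
      using r by (auto simp: g_def norm_mult norm_power r_def sum_nonneg abs_mult intro!: mult_right_mono)
  qed
qed

text \<open>Finitely many finite sets have a common upper bound, so these power sets are cofinal. An
  unconditional sum over \<open>Fpow {1..}\<close> can thus be evaluated as a limit along
  them.\<close>

lemma filterlim_Pow_atLeastAtMost: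
  "filterlim (\<lambda>M. Pow {1..M}) (finite_subsets_at_top (Fpow {1..})) (sequentially :: nat filter)"
  unfolding filterlim_finite_subsets_at_top
proof (intro allI impI)
  fix X :: "nat set set" assume X: "finite X \<and> X \<subseteq> Fpow {1..}"
  then have "finite (\<Union>X)" by (auto simp: Fpow_def)
  then obtain N where N: "\<Union>X \<subseteq> {..N}"
    using finite_nat_iff_bounded_le by blast
  show "\<forall>\<^sub>F M in sequentially. finite (Pow {1..M}) \<and> X \<subseteq> Pow {1..M} \<and> Pow {1..M} \<subseteq> Fpow {1..}"
    using eventually_ge_at_top[of N]
  proof eventually_elim
    case (elim M)
    have "A \<subseteq> {1..M}" if "A \<in> X" for A
      using that X N elim by (fastforce simp: Fpow_def)
    then show ?case
      by (auto simp: Fpow_def intro: finite_subset)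
  qed
qed

text \<open>A multiset with multiplicities at most 1 is determined by its support, so
  \<open>set_mset\<close> and \<open>mset_set\<close> are mutually inverse between partitions into
  distinct parts and finite sets of positive integers.\<close>

lemma DSOME_eq_sum_sets:
  "DSOME n = (\<Sum>A | A \<in> Fpow {1..} \<and> \<Sum>A = n. \<Sum>k\<in>A. if odd k then int k else - int k)"
  unfolding DSOME_def
proof (rule sum.reindex_bij_witness[where i = mset_set and j = set_mset])
  fix p assume p: "p \<in> distinct_partitions n"
  then have "count p x \<le> 1" for x
    by (simp add: distinct_partitions_def)
  then have eq: "mset_set (set_mset p) = p"
    by (intro multiset_eqI) (auto simp: count_mset_set' le_Suc_eq count_eq_zero_iff)
  then show "mset_set (set_mset p) = p" .
  have "\<Sum>(set_mset p) = \<Sum>\<^sub># p"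
    using sum_unfold_sum_mset[of "\<lambda>x. x" "set_mset p"] eq by simp
  moreover have "0 \<notin># p" and "\<Sum>\<^sub># p = n"
    using p by (auto simp: distinct_partitions_def partitions_def)
  ultimately show "set_mset p \<in> {A. A \<in> Fpow {1..} \<and> \<Sum>A = n}"
    by (auto simp: Fpow_def Suc_le_eq intro: gr0I)
  have "(\<Sum>k\<in>set_mset p. if odd k then int k else - int k) =
      (\<Sum>k | k \<in># p \<and> odd k. int k) - (\<Sum>k | k \<in># p \<and> even k. int k)"
    by (simp add: sum.If_cases sum_negf Int_def)
  also have "\<dots> = (\<Sum>x\<in>#filter_mset odd (mset_set (set_mset p)). int x) -
      (\<Sum>x\<in>#filter_mset even (mset_set (set_mset p)). int x)"
    by (simp add: sum_unfold_sum_mset)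
  finally show "(\<Sum>k\<in>set_mset p. if odd k then int k else - int k) =
      (\<Sum>x\<in>#filter_mset odd p. int x) - (\<Sum>x\<in>#filter_mset even p. int x)"
    by (simp add: eq)
next
  fix A assume "A \<in> {A. A \<in> Fpow {1..} \<and> \<Sum>A = n}"
  then have A: "finite A" "A \<subseteq> {1..}" "\<Sum>A = n"
    by (auto simp: Fpow_def)
  then show "set_mset (mset_set A) = A" by simp
  show "mset_set A \<in> distinct_partitions n"
    using A sum_unfold_sum_mset[of "\<lambda>x. x" A]
    by (auto simp: distinct_partitions_def partitions_def count_mset_set')
qed

lemma finite_sets_with_sum: "finite {A. A \<in> Fpow {1..} \<and> \<Sum>A = (n :: nat)}"
proof (rule finite_subset)
  show "{A. A \<in> Fpow {1..} \<and> \<Sum>A = n} \<subseteq> Pow {..n}"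
    by (auto simp: Fpow_def intro: member_le_sum)
qed simp

text \<open>The sum over all finite sets of positive integers is evaluated twice: along the sets
  \<open>Pow {1..M}\<close> it tends to \<open>L\<close>, and grouped by the total \<open>n\<close>
  of each set it is the power series of \<open>DSOME\<close>.\<close>

lemma DSOME_sums_of_LIMSEQ:
  fixes q :: complex
  assumes q: "norm q < 1"
    and lim: "(\<lambda>M. (\<Prod>k=1..M. 1 + q ^ k) *
      (\<Sum>k=1..M. (if odd k then of_nat k else - of_nat k) * q ^ k / (1 + q ^ k))) \<longlonglongrightarrow> L"
  shows "(\<lambda>n. of_int (DSOME n) * q ^ n) sums L"
proof -
  define w :: "nat \<Rightarrow> complex" where "w k = (if odd k then of_nat k else - of_nat k)" for k
  define f where "f A = (\<Sum>k\<in>A. w k) * q ^ \<Sum>A" for A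
  define D where "D n = {A. A \<in> Fpow {1..} \<and> \<Sum>A = n}" for n :: nat
  have "(\<lambda>A. norm (f A)) summable_on Fpow {1..}"
    unfolding f_def using q by (rule weighted_distinct_sets_abs_summable) (simp add: w_def)
  then obtain S where S: "(f has_sum S) (Fpow {1..})"
    using abs_summable_summable summable_on_def by blast
  then have "(\<lambda>M. sum f (Pow {1..M})) \<longlonglongrightarrow> S"
    unfolding has_sum_def using filterlim_Pow_atLeastAtMost by (rule filterlim_compose)
  moreover have "(\<lambda>M. sum f (Pow {1..M})) \<longlonglongrightarrow> L"
    using lim unfolding f_def sum_Pow_weighted_power[OF q] w_def .
  ultimately have "S = L"
    by (rule LIMSEQ_unique)
  \<comment> \<open>Every finite set lies in exactly one class \<open>D n\<close>, namely the one
    for its own total.\<close>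
  have "bij_betw snd (Sigma UNIV D) (Fpow {1..})"
    by (rule bij_betwI[where g = "\<lambda>A. (\<Sum>A, A)"]) (auto simp: D_def)
  from has_sum_reindex_bij_betw[OF this, of f S] S
  have "((\<lambda>x. f (snd x)) has_sum S) (Sigma UNIV D)" by simp
  moreover have "((\<lambda>A. f (snd (n, A))) has_sum (of_int (DSOME n) * q ^ n)) (D n)" for n
  proof -
    have "of_int (DSOME n) = (\<Sum>A\<in>D n. \<Sum>k\<in>A. w k)"
      unfolding DSOME_eq_sum_sets of_int_sum D_def by (intro sum.cong refl) (simp add: w_def)
    then have "of_int (DSOME n) * q ^ n = (\<Sum>A\<in>D n. (\<Sum>k\<in>A. w k) * q ^ n)"
      by (metis sum_distrib_right)
    also have "\<dots> = (\<Sum>A\<in>D n. f A)"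
      by (intro sum.cong) (auto simp: D_def f_def)
    finally have "of_int (DSOME n) * q ^ n = (\<Sum>A\<in>D n. f A)" .
    then show ?thesis
      using finite_sets_with_sum[of n] by (simp add: D_def has_sum_finite)
  qed
  ultimately have "((\<lambda>n. of_int (DSOME n) * q ^ n) has_sum S) UNIV"
    by (rule has_sum_SigmaD)
  then show ?thesis
    unfolding \<open>S = L\<close> by (rule has_sum_imp_sums)
qed

section \<open>Closed form of the generating function\<close>

theorem theorem1p1:
  fixes q :: complex
  assumes "norm q < 1"
  shows "(\<lambda>n. of_int (DSOME n) * q ^ n) sums
    (1 / 8 * (euler_f 2 q / euler_f 1 q - euler_f 1 q ^ 7 / euler_f 2 q ^ 3))"
proof -
  define P where "P = euler_f 1 q ^ 2 / euler_f 2 q"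
  have nz: "euler_f 1 q \<noteq> 0" "euler_f 2 q \<noteq> 0"
    using prod_one_minus_power_LIMSEQ(2)[OF assms] by auto
  have "(\<lambda>k. (-1) ^ k * of_nat (Suc k) * q ^ Suc k / (1 + q ^ Suc k)) sums ((1 - P ^ 4) / 8)"
  \<comment> \<open>At \<open>q = 0\<close> the interpolation nodes \<open>q ^ i\<close> are not
    distinct, so this case is checked directly: \<open>P = 1\<close> and every term of the series
    vanishes.\<close>
  proof (cases "q = 0")
    case True
    then have "P = 1"
      by (simp add: P_def euler_f_def qpochhammer_inf_def)
    then show ?thesis using True by simp
  next
    case False
    then show ?thesis
      using alternating_lambert_swap[OF assms] euler_f_quartic_eq_alternating_series[OF assms]
      by (simp add: P_def)
  qed
  then have "(\<lambda>M. \<Sum>k<M. (-1) ^ k * of_nat (Suc k) * q ^ Suc k / (1 + q ^ Suc k)) \<longlonglongrightarrow> (1 - P ^ 4) / 8"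
    by (simp add: sums_def)
  moreover have "(\<Sum>k<M. (-1) ^ k * of_nat (Suc k) * q ^ Suc k / (1 + q ^ Suc k)) =
      (\<Sum>k=1..M. (if odd k then of_nat k else - of_nat k) * q ^ k / (1 + q ^ k))" for M
    by (rule sum.reindex_bij_witness[where i = "\<lambda>k. k - 1" and j = Suc])
       (auto simp del: of_nat_Suc)
  ultimately have "(\<lambda>M. (\<Prod>k=1..M. 1 + q ^ k) *
      (\<Sum>k=1..M. (if odd k then of_nat k else - of_nat k) * q ^ k / (1 + q ^ k)))
      \<longlonglongrightarrow> euler_f 2 q / euler_f 1 q * ((1 - P ^ 4) / 8)"
    using prod_one_plus_power_LIMSEQ[OF assms] by (intro tendsto_mult) simp_all
  then have "(\<lambda>n. of_int (DSOME n) * q ^ n) sums (euler_f 2 q / euler_f 1 q * ((1 - P ^ 4) / 8))"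
    by (rule DSOME_sums_of_LIMSEQ[OF assms])
  \<comment> \<open>One factor is split off above and below so that it cancels against the prefactor
    \<open>euler_f 2 q / euler_f 1 q\<close>.\<close>
  also have "P ^ 4 = euler_f 1 q * euler_f 1 q ^ 7 / (euler_f 2 q * euler_f 2 q ^ 3)"
    unfolding P_def power_divide power_mult[symmetric] power_Suc[symmetric] by simp
  also have "euler_f 2 q / euler_f 1 q *
        ((1 - euler_f 1 q * euler_f 1 q ^ 7 / (euler_f 2 q * euler_f 2 q ^ 3)) / 8) =
      1 / 8 * (euler_f 2 q / euler_f 1 q - euler_f 1 q ^ 7 / euler_f 2 q ^ 3)"
  proof -
    have "b / a * ((1 - a * c / (b * d)) / 8) = 1 / 8 * (b / a - c / d)"
      if "a \<noteq> 0" "b \<noteq> 0" for a b c d :: complex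
      using that by (simp add: right_diff_distrib diff_divide_distrib mult_ac)
    then show ?thesis using nz by blast
  qed
  finally show ?thesis .
qed

end
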